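(* Let $j\geq 2$ be an integer, let $n,m\geq j$ be integers, and let $f\in C^{2,2}([0,1]^2)$. Then for all $(x,y)\in[0,1]^2$, $$\left|f(x,y)-B_{n,m,j}(f;x,y)\right|\leq \frac{x(1-x)}{2n}\|f^{(2,0)}\|+\frac{y(1-y)}{2m}\|f^{(0,2)}\|+\frac{j-1}{n}\|f^{(1,0)}\|+\frac{j-1}{m}\|f^{(0,1)}\|.$$
   Context: With $p_{n,i}(x)=\binom{n}{i}x^i(1-x)^{n-i}$, the bivariate Aldaz-Kounchev-Render operator is defined for $f\in C([0,1]^2)$ by $$B_{n,m,j}(f;x,y)=\sum_{i=0}^{n}\sum_{k=0}^{m}f\left(t_{n,i}^j,t_{m,k}^j\right)p_{n,i}(x)p_{m,k}(y),\quad (x,y)\in[0,1]^2,$$ where $$t_{n,k}^j=\left(\frac{k(k-1)\cdots(k-j+1)}{n(n-1)\cdots(n-j+1)}\right)^{1/j}$$ (the superscript $j$ in $t_{n,k}^j$ is an index, not a power). $C^{p,q}([0,1]^2)$ denotes the space of all real-valued functions on $[0,1]^2$ having continuous partial derivatives of order $p$ in the first variable, respectively $q$ in the second variable, i.e. all partial derivatives $f^{(k,l)}=\partial^{k+l}f/\partial x^k\partial y^l$ with $0\le k\le p$, $0\le l\le q$ exist and are continuous on $[0,1]^2$. $\|\cdot\|$ is the supremum norm on $[0,1]^2$. *)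

theory Defs
  imports "HOL-Analysis.Analysis"
begin

abbreviation unit_square :: "(real \<times> real) set" where
  "unit_square \<equiv> {0..1} \<times> {0..1}"

(* Derivatives are taken within [0,1], hence are one-sided on the boundary of the square;
   the values on the square depend only on the restriction of the function to the square. *)
definition partial_x :: "(real \<times> real \<Rightarrow> real) \<Rightarrow> real \<times> real \<Rightarrow> real" where
  "partial_x f = (\<lambda>(x, y). vector_derivative (\<lambda>s. f (s, y)) (at x within {0..1}))"

definition partial_y :: "(real \<times> real \<Rightarrow> real) \<Rightarrow> real \<times> real \<Rightarrow> real" where
  "partial_y f = (\<lambda>(x, y). vector_derivative (\<lambda>t. f (x, t)) (at y within {0..1}))"

definition mixed_partial :: "nat \<Rightarrow> nat \<Rightarrow> (real \<times> real \<Rightarrow> real) \<Rightarrow> real \<times> real \<Rightarrow> real" where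
  "mixed_partial k l f = (partial_x ^^ k) ((partial_y ^^ l) f)"

(* The first two conjuncts express the existence of all mixed_partial k l f, k \<le> p, l \<le> q:
   they are needed because vector_derivative is an unspecified value
   where the derivative does not exist. *)
definition C_pq :: "nat \<Rightarrow> nat \<Rightarrow> (real \<times> real \<Rightarrow> real) set" where
  "C_pq p q = {f.
     (\<forall>l<q. \<forall>(x, y)\<in>unit_square.
        (\<lambda>t. mixed_partial 0 l f (x, t)) differentiable (at y within {0..1})) \<and>
     (\<forall>k<p. \<forall>l\<le>q. \<forall>(x, y)\<in>unit_square.
        (\<lambda>s. mixed_partial k l f (s, y)) differentiable (at x within {0..1})) \<and>
     (\<forall>k\<le>p. \<forall>l\<le>q. continuous_on unit_square (mixed_partial k l f))}"

(* For g continuous on the square the set of values is bounded, so SUP is the true supremum. *)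
definition sup_norm :: "(real \<times> real \<Rightarrow> real) \<Rightarrow> real" where
  "sup_norm g = (SUP z\<in>unit_square. \<bar>g z\<bar>)"

(* For k < j the numerator has the factor k - k = 0, so the node is 0. *)
definition akr_node :: "nat \<Rightarrow> nat \<Rightarrow> nat \<Rightarrow> real" where
  "akr_node j n k =
     root j ((\<Prod>r<j. real k - real r) / (\<Prod>r<j. real n - real r))"

definition akr_operator ::
  "nat \<Rightarrow> nat \<Rightarrow> nat \<Rightarrow> (real \<times> real \<Rightarrow> real) \<Rightarrow> real \<times> real \<Rightarrow> real" where
  "akr_operator n m j f = (\<lambda>(x, y).
     \<Sum>i\<le>n. \<Sum>k\<le>m. f (akr_node j n i, akr_node j m k) * Bernstein n i x * Bernstein m k y)"

end

theory Submission
  imports Defs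
begin

text \<open>
  The operator is the composition of two univariate operators
  \<open>g \<mapsto> (\<Sum>i\<le>n. g (t i) * Bernstein n i x)\<close>, one per variable, and each of them is an
  averaging operator, because the Bernstein polynomials are nonnegative on the unit interval and
  add up to 1. Inserting the function to which only the operator in the first variable
  has been applied splits the error into a univariate error in the first variable and an average of
  univariate errors in the second variable. No mixed derivative appears, since
  an average of errors is at most their common bound.

  For the univariate error (lemma \<open>perturbed_Bernstein_error\<close>) compare with the
  classical Bernstein operator, whose nodes are \<open>i / n\<close>. The Taylor expansion of \<open>g\<close> at
  \<open>x\<close> has a remainder of at most \<open>M2 / 2 * (i / n - x)\<^sup>2\<close>, its linear term averages to 0,
  and the variance \<open>x * (1 - x) / n\<close> of the Bernstein weights turns the remainder into the
  term with the second derivative. Moving the nodes by at most \<open>\<delta>\<close> costs at most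
  \<open>\<delta> * M1\<close> by the mean value theorem. For the nodes at hand
  \<open>\<delta> = (j - 1) / n\<close> (lemma \<open>akr_node_bounds\<close>): for \<open>k \<ge> j\<close> the node is the geometric
  mean of the quotients \<open>(k - r) / (n - r)\<close> with \<open>r < j\<close>, all of which lie between
  \<open>(k - (j - 1)) / n\<close> and \<open>k / n\<close>; for \<open>k < j\<close> it is \<open>0\<close>, and \<open>k / n\<close> is
  itself at most \<open>(j - 1) / n\<close>.
\<close>

section \<open>Mean value and Taylor estimates on the unit interval\<close>

text \<open>
  The points \<open>a\<close> and \<open>b\<close> may come in either order, which spares a case distinction
  wherever an expansion point lies between the nodes.
\<close>

lemma mvt_unit_interval:
  fixes g g' :: "real \<Rightarrow> real"
  assumes deriv: "\<And>s. s \<in> {0..1} \<Longrightarrow> (g has_real_derivative g' s) (at s within {0..1})"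
    and ab: "a \<in> {0..1}" "b \<in> {0..1}"
  shows "\<exists>c \<in> closed_segment a b. g b - g a = g' c * (b - a)"
proof -
  have ordered: "\<exists>c \<in> {u..v}. g v - g u = g' c * (v - u)"
    if "u < v" "u \<in> {0..1}" "v \<in> {0..1}" for u v
  proof -
    have "(g has_derivative (*) (g' s)) (at s within {u..v})" if "u \<le> s" "s \<le> v" for s
      using has_field_derivative_subset[OF deriv, of s "{u..v}"] \<open>u \<in> {0..1}\<close> \<open>v \<in> {0..1}\<close> that
      by (simp add: has_field_derivative_def)
    from mvt_simple[OF \<open>u < v\<close> this] show ?thesis
      by (meson greaterThanLessThan_subseteq_atLeastAtMost_iff order_refl subsetD)
  qed
  consider "a < b" | "a = b" | "b < a" by linarith
  then show ?thesis
  proof cases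
    case 1
    with ordered[of a b] ab show ?thesis by (simp add: closed_segment_eq_real_ivl)
  next
    case 2
    then show ?thesis by auto
  next
    case 3
    with ordered[of b a] ab obtain c where "c \<in> {b..a}" "g a - g b = g' c * (a - b)" by blast
    with 3 show ?thesis
      by (intro bexI[of _ c]) (auto simp: closed_segment_eq_real_ivl algebra_simps)
  qed
qed

lemma lipschitz_unit_interval:
  fixes g g' :: "real \<Rightarrow> real"
  assumes deriv: "\<And>s. s \<in> {0..1} \<Longrightarrow> (g has_real_derivative g' s) (at s within {0..1})"
    and M: "\<And>s. s \<in> {0..1} \<Longrightarrow> \<bar>g' s\<bar> \<le> M"
    and ab: "a \<in> {0..1}" "b \<in> {0..1}"
  shows "\<bar>g b - g a\<bar> \<le> M * \<bar>b - a\<bar>"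
proof -
  obtain c where c: "c \<in> closed_segment a b" "g b - g a = g' c * (b - a)"
    using mvt_unit_interval[OF deriv ab] by blast
  then have "c \<in> {0..1}"
    using ab by (auto simp: closed_segment_eq_real_ivl split: if_splits)
  with c M show ?thesis
    by (simp add: abs_mult mult_right_mono)
qed

text \<open>
  The function minus its tangent and minus the parabola has, by the mean value theorem, increment
  \<open>(g' c - g' a - M * (c - a)) * (b - a)\<close>; a second application to \<open>g'\<close> writes this as
  \<open>(g'' e - M) * (c - a) * (b - a)\<close>, where the last two factors have the same sign.
\<close>

lemma quadratic_upper_bound:
  fixes g g' g'' :: "real \<Rightarrow> real"
  assumes g: "\<And>s. s \<in> {0..1} \<Longrightarrow> (g has_real_derivative g' s) (at s within {0..1})"
    and g': "\<And>s. s \<in> {0..1} \<Longrightarrow> (g' has_real_derivative g'' s) (at s within {0..1})"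
    and M: "\<And>s. s \<in> {0..1} \<Longrightarrow> g'' s \<le> M"
    and ab: "a \<in> {0..1}" "b \<in> {0..1}"
  shows "g b - g a - g' a * (b - a) \<le> M / 2 * (b - a)\<^sup>2"
proof -
  define h where "h = (\<lambda>s. g s - g' a * (s - a) - M / 2 * (s - a)\<^sup>2)"
  have "(h has_real_derivative (g' s - g' a - M * (s - a))) (at s within {0..1})"
    if "s \<in> {0..1}" for s
    unfolding h_def by (rule derivative_eq_intros g[OF that] refl | simp)+
  from mvt_unit_interval[OF this ab] obtain c where c: "c \<in> closed_segment a b"
    and h: "h b - h a = (g' c - g' a - M * (c - a)) * (b - a)" by blast
  have c01: "c \<in> {0..1}"
    using c ab by (auto simp: closed_segment_eq_real_ivl split: if_splits)
  obtain e where e: "e \<in> closed_segment a c" and "g' c - g' a = g'' e * (c - a)"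
    using mvt_unit_interval[OF g' ab(1) c01] by blast
  with h have "h b - h a = (g'' e - M) * ((c - a) * (b - a))"
    by (simp add: algebra_simps)
  moreover have "g'' e \<le> M"
    using M e ab c01 by (auto simp: closed_segment_eq_real_ivl split: if_splits)
  moreover have "(c - a) * (b - a) \<ge> 0"
    using c by (auto simp: closed_segment_eq_real_ivl zero_le_mult_iff split: if_splits)
  ultimately have "h b \<le> h a"
    using mult_nonpos_nonneg[of "g'' e - M" "(c - a) * (b - a)"] by simp
  then show ?thesis by (simp add: h_def)
qed

text \<open>
  The one-sided estimate applies to \<open>g\<close> and to \<open>- g\<close>.
\<close>

lemma taylor_remainder_bound:
  fixes g g' g'' :: "real \<Rightarrow> real"
  assumes g: "\<And>s. s \<in> {0..1} \<Longrightarrow> (g has_real_derivative g' s) (at s within {0..1})"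
    and g': "\<And>s. s \<in> {0..1} \<Longrightarrow> (g' has_real_derivative g'' s) (at s within {0..1})"
    and M: "\<And>s. s \<in> {0..1} \<Longrightarrow> \<bar>g'' s\<bar> \<le> M"
    and ab: "a \<in> {0..1}" "b \<in> {0..1}"
  shows "\<bar>g b - g a - g' a * (b - a)\<bar> \<le> M / 2 * (b - a)\<^sup>2"
proof -
  have bounds: "g'' s \<le> M" "- g'' s \<le> M" if "s \<in> {0..1}" for s
    using M[OF that] by linarith+
  have "- g b - - g a - - g' a * (b - a) \<le> M / 2 * (b - a)\<^sup>2"
    by (rule quadratic_upper_bound[where g = "\<lambda>s. - g s" and g' = "\<lambda>s. - g' s"
          and g'' = "\<lambda>s. - g'' s"])
      (use ab bounds(2) in \<open>auto intro!: DERIV_minus g g'\<close>)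
  moreover have "g b - g a - g' a * (b - a) \<le> M / 2 * (b - a)\<^sup>2"
    using quadratic_upper_bound[OF g g' bounds(1) ab] by blast
  ultimately show ?thesis by linarith
qed

section \<open>Averaging with Bernstein weights\<close>

lemma Bernstein_first_moment:
  assumes "n > 0"
  shows "(\<Sum>i\<le>n. (real i / real n - x) * Bernstein n i x) = 0"
proof -
  have "(\<Sum>i\<le>n. (real i / real n - x) * Bernstein n i x)
      = (\<Sum>i\<le>n. real i * Bernstein n i x) / real n - x * (\<Sum>i\<le>n. Bernstein n i x)"
    by (simp only: left_diff_distrib times_divide_eq_left sum_subtractf sum_distrib_left
        sum_divide_distrib)
  with assms show ?thesis by simp
qed

lemma Bernstein_second_moment:
  assumes "n > 0"
  shows "(\<Sum>i\<le>n. (real i / real n - x)\<^sup>2 * Bernstein n i x) = x * (1 - x) / real n"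
proof -
  let ?p = "\<lambda>i. Bernstein n i x"
  define a where "a = 1 / real n"
  have na: "real n * a = 1" and frac: "z / real n = z * a" for z
    using assms by (simp_all add: a_def)
  \<comment> \<open>The second factorial moment is the one with a closed form, so squares are expressed by it.\<close>
  have "(real i * a - x)\<^sup>2 * ?p i
      = a\<^sup>2 * (real i * (real i - 1) * ?p i) + (a\<^sup>2 - 2 * x * a) * (real i * ?p i) + x\<^sup>2 * ?p i" for i
    by algebra
  then have "(\<Sum>i\<le>n. (real i * a - x)\<^sup>2 * ?p i)
      = a\<^sup>2 * (\<Sum>i\<le>n. real i * (real i - 1) * ?p i)
        + (a\<^sup>2 - 2 * x * a) * (\<Sum>i\<le>n. real i * ?p i) + x\<^sup>2 * (\<Sum>i\<le>n. ?p i)"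
    by (simp only: sum.distrib sum_distrib_left)
  also have "\<dots> = a\<^sup>2 * (real n * (real n - 1) * x\<^sup>2) + (a\<^sup>2 - 2 * x * a) * (real n * x) + x\<^sup>2"
    by (simp only: sum_kk_Bernstein sum_k_Bernstein sum_Bernstein mult_1_right)
  also have "\<dots> = x * (1 - x) * a"
    using na by algebra
  finally show ?thesis by (simp only: frac)
qed

lemma abs_Bernstein_average_le:
  assumes "x \<in> {0..1}" and "\<And>i. i \<le> n \<Longrightarrow> \<bar>c i\<bar> \<le> M"
  shows "\<bar>\<Sum>i\<le>n. c i * Bernstein n i x\<bar> \<le> M"
proof -
  have "\<bar>\<Sum>i\<le>n. c i * Bernstein n i x\<bar> \<le> (\<Sum>i\<le>n. M * Bernstein n i x)"
    using assms
    by (intro order_trans[OF sum_abs] sum_mono)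
      (auto simp: abs_mult Bernstein_nonneg intro!: mult_right_mono)
  also have "\<dots> = M" by (simp flip: sum_distrib_left)
  finally show ?thesis .
qed

text \<open>
  The error is the effect of moving the nodes minus the average of the Taylor remainders \<open>rem\<close> at
  the nodes \<open>i / n\<close>. A
  uniform bound for \<open>rem\<close> would lose the factor \<open>1 / n\<close>, which only the average of the
  quadratic bounds, the variance, supplies.
\<close>

lemma perturbed_Bernstein_error:
  fixes g g' g'' :: "real \<Rightarrow> real" and t :: "nat \<Rightarrow> real"
  assumes g: "\<And>s. s \<in> {0..1} \<Longrightarrow> (g has_real_derivative g' s) (at s within {0..1})"
    and g': "\<And>s. s \<in> {0..1} \<Longrightarrow> (g' has_real_derivative g'' s) (at s within {0..1})"
    and M1: "\<And>s. s \<in> {0..1} \<Longrightarrow> \<bar>g' s\<bar> \<le> M1"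
    and M2: "\<And>s. s \<in> {0..1} \<Longrightarrow> \<bar>g'' s\<bar> \<le> M2"
    and t: "\<And>i. i \<le> n \<Longrightarrow> t i \<in> {0..1}"
    and \<delta>: "\<And>i. i \<le> n \<Longrightarrow> \<bar>real i / real n - t i\<bar> \<le> \<delta>"
    and "n > 0" and x: "x \<in> {0..1}"
  shows "\<bar>g x - (\<Sum>i\<le>n. g (t i) * Bernstein n i x)\<bar> \<le> x * (1 - x) / (2 * real n) * M2 + \<delta> * M1"
proof -
  let ?p = "\<lambda>i. Bernstein n i x"
  define rem where "rem = (\<lambda>i. g (real i / real n) - g x - g' x * (real i / real n - x))"
  have node01: "real i / real n \<in> {0..1}" if "i \<le> n" for i
    using that \<open>n > 0\<close> by simp
  have "(\<Sum>i\<le>n. rem i * ?p i) = (\<Sum>i\<le>n. g (real i / real n) * ?p i) - g x * (\<Sum>i\<le>n. ?p i)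
      - g' x * (\<Sum>i\<le>n. (real i / real n - x) * ?p i)"
    by (simp only: rem_def left_diff_distrib right_diff_distrib[of "g' x"] sum_subtractf
        sum_distrib_left mult.assoc)
  then have split: "g x - (\<Sum>i\<le>n. g (t i) * ?p i)
      = (\<Sum>i\<le>n. (g (real i / real n) - g (t i)) * ?p i) - (\<Sum>i\<le>n. rem i * ?p i)"
    using Bernstein_first_moment[OF \<open>n > 0\<close>, of x] by (simp add: left_diff_distrib sum_subtractf)
  have "\<bar>\<Sum>i\<le>n. rem i * ?p i\<bar> \<le> (\<Sum>i\<le>n. M2 / 2 * ((real i / real n - x)\<^sup>2 * ?p i))"
  proof (intro order_trans[OF sum_abs] sum_mono)
    fix i assume "i \<in> {..n}"
    then have "\<bar>rem i\<bar> \<le> M2 / 2 * (real i / real n - x)\<^sup>2"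
      unfolding rem_def by (intro taylor_remainder_bound[OF g g' M2 x node01]) auto
    then have "\<bar>rem i\<bar> * ?p i \<le> M2 / 2 * (real i / real n - x)\<^sup>2 * ?p i"
      using x by (intro mult_right_mono Bernstein_nonneg) auto
    then show "\<bar>rem i * ?p i\<bar> \<le> M2 / 2 * ((real i / real n - x)\<^sup>2 * ?p i)"
      using x by (simp add: abs_mult Bernstein_nonneg mult.assoc)
  qed
  also have "\<dots> = x * (1 - x) / (2 * real n) * M2"
    by (simp only: Bernstein_second_moment[OF \<open>n > 0\<close>] flip: sum_distrib_left) simp
  finally have classical: "\<bar>\<Sum>i\<le>n. rem i * ?p i\<bar> \<le> x * (1 - x) / (2 * real n) * M2" .
  have "M1 \<ge> 0" using M1[OF x] by linarith
  have "\<bar>g (real i / real n) - g (t i)\<bar> \<le> \<delta> * M1" if "i \<le> n" for i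
  proof -
    have "\<bar>g (real i / real n) - g (t i)\<bar> \<le> M1 * \<bar>real i / real n - t i\<bar>"
      using lipschitz_unit_interval[OF g M1 t[OF that] node01[OF that]] by blast
    also have "\<dots> \<le> M1 * \<delta>"
      using \<delta>[OF that] \<open>M1 \<ge> 0\<close> by (rule mult_left_mono)
    finally show ?thesis by (simp add: mult.commute)
  qed
  then have "\<bar>\<Sum>i\<le>n. (g (real i / real n) - g (t i)) * ?p i\<bar> \<le> \<delta> * M1"
    using x by (intro abs_Bernstein_average_le) auto
  with classical split show ?thesis by linarith
qed

section \<open>Location of the nodes\<close>

lemma akr_node_bounds:
  assumes "0 < j" "j \<le> n" "k \<le> n"
  shows "akr_node j n k \<in> {0..1}"
    and "\<bar>real k / real n - akr_node j n k\<bar> \<le> (real j - 1) / real n"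
proof -
  have "n > 0" using assms by simp
  have node: "akr_node j n k = root j (\<Prod>r<j. (real k - real r) / (real n - real r))"
    by (simp add: akr_node_def prod_dividef)
  have bounds: "0 \<le> akr_node j n k \<and> akr_node j n k \<le> real k / real n
    \<and> (real k - (real j - 1)) / real n \<le> akr_node j n k"
  proof (cases "k < j")
    case True
    \<comment> \<open>The node vanishes, and the lower bound holds because \<open>k \<le> j - 1\<close>.\<close>
    have "(\<Prod>r<j. real k - real r) = 0"
      using True by (intro prod_zero) auto
    then have "akr_node j n k = 0" by (simp add: akr_node_def)
    moreover have "real k + 1 \<le> real j" using True by linarith
    ultimately show ?thesis by (simp add: divide_nonpos_nonneg)
  next
    case False
    then have "j \<le> k" by simp
    have factor: "(real k - real r) / (real n - real r) \<le> real k / real n"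
      "(real k - (real j - 1)) / real n \<le> (real k - real r) / (real n - real r)"
      if "r < j" for r
    proof -
      have r: "real r < real n" "real r + 1 \<le> real j" "real j \<le> real k" "real k \<le> real n"
        using that assms \<open>j \<le> k\<close> by linarith+
      have "real k * real r \<le> real n * real r"
        using r by (intro mult_right_mono) auto
      then show "(real k - real r) / (real n - real r) \<le> real k / real n"
        using r by (simp add: field_simps)
      show "(real k - (real j - 1)) / real n \<le> (real k - real r) / (real n - real r)"
        using r by (intro frac_le) auto
    qed
    have low: "(real k - (real j - 1)) / real n \<ge> 0"
      using \<open>j \<le> k\<close> by simp
    have "((real k - (real j - 1)) / real n) ^ j \<le> (\<Prod>r<j. (real k - real r) / (real n - real r))"
      using prod_mono[of "{..<j}" "\<lambda>_. (real k - (real j - 1)) / real n"] factor(2) low by simp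
    then have "root j (((real k - (real j - 1)) / real n) ^ j) \<le> akr_node j n k"
      unfolding node using assms(1) by (intro real_root_le_mono)
    then have lower: "(real k - (real j - 1)) / real n \<le> akr_node j n k"
      using assms(1) low by (simp only: real_root_power_cancel)
    have "(\<Prod>r<j. (real k - real r) / (real n - real r)) \<le> (real k / real n) ^ j"
      using prod_mono[of "{..<j}" "\<lambda>r. (real k - real r) / (real n - real r)" "\<lambda>_. real k / real n"]
        factor order_trans[OF low factor(2)] by simp
    then have "akr_node j n k \<le> root j ((real k / real n) ^ j)"
      unfolding node using assms(1) by (intro real_root_le_mono)
    then have "akr_node j n k \<le> real k / real n"
      using assms(1) by (simp add: real_root_power_cancel)
    with lower low show ?thesis by linarith
  qed
  have "real k / real n \<le> 1" using assms \<open>n > 0\<close> by simp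
  with bounds show "akr_node j n k \<in> {0..1}" by auto
  show "\<bar>real k / real n - akr_node j n k\<bar> \<le> (real j - 1) / real n"
    using bounds by (simp add: diff_divide_distrib abs_le_iff)
qed

section \<open>Partial derivatives and the error bound on the square\<close>

text \<open>
  A supremum of reals bounds its set only if the set is bounded, which continuity on the compact
  square provides.
\<close>

lemma abs_le_sup_norm:
  assumes "continuous_on unit_square g" and "z \<in> unit_square"
  shows "\<bar>g z\<bar> \<le> sup_norm g"
proof -
  have "compact ((\<lambda>z. \<bar>g z\<bar>) ` unit_square)"
    using assms(1) by (intro compact_continuous_image continuous_intros compact_Times) auto
  then have "bdd_above ((\<lambda>z. \<bar>g z\<bar>) ` unit_square)"
    by (intro bounded_imp_bdd_above compact_imp_bounded)
  with assms(2) show ?thesis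
    unfolding sup_norm_def by (intro cSUP_upper)
qed

lemma C_pq_derivative_x:
  assumes "f \<in> C_pq p q" "k < p" "l \<le> q" "(x, y) \<in> unit_square"
  shows "((\<lambda>s. mixed_partial k l f (s, y)) has_real_derivative mixed_partial (Suc k) l f (x, y))
    (at x within {0..1})"
proof -
  have "\<forall>(x, y)\<in>unit_square.
      (\<lambda>s. mixed_partial k l f (s, y)) differentiable (at x within {0..1})"
    using assms(1-3) unfolding C_pq_def mem_Collect_eq by metis
  from bspec[OF this assms(4)]
  have "(\<lambda>s. mixed_partial k l f (s, y)) differentiable (at x within {0..1})"
    by simp
  then show ?thesis
    by (simp add: vector_derivative_works has_real_derivative_iff_has_vector_derivative
        mixed_partial_def partial_x_def)
qed

lemma C_pq_derivative_y:
  assumes "f \<in> C_pq p q" "l < q" "(x, y) \<in> unit_square"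
  shows "((\<lambda>t. mixed_partial 0 l f (x, t)) has_real_derivative mixed_partial 0 (Suc l) f (x, y))
    (at y within {0..1})"
proof -
  have "\<forall>(x, y)\<in>unit_square.
      (\<lambda>t. mixed_partial 0 l f (x, t)) differentiable (at y within {0..1})"
    using assms(1,2) unfolding C_pq_def mem_Collect_eq by metis
  from bspec[OF this assms(3)]
  have "(\<lambda>t. mixed_partial 0 l f (x, t)) differentiable (at y within {0..1})"
    by simp
  then show ?thesis
    by (simp add: vector_derivative_works has_real_derivative_iff_has_vector_derivative
        mixed_partial_def partial_y_def)
qed

lemma C_pq_abs_le_sup_norm:
  assumes "f \<in> C_pq p q" "k \<le> p" "l \<le> q" "z \<in> unit_square"
  shows "\<bar>mixed_partial k l f z\<bar> \<le> sup_norm (mixed_partial k l f)"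
proof -
  have "continuous_on unit_square (mixed_partial k l f)"
    using assms(1-3) unfolding C_pq_def mem_Collect_eq by metis
  then show ?thesis using assms(4) by (rule abs_le_sup_norm)
qed

theorem proposition4p1:
  fixes j n m :: nat and f :: "real \<times> real \<Rightarrow> real" and x y :: real
  assumes "j \<ge> 2" and "n \<ge> j" and "m \<ge> j"
    and "f \<in> C_pq 2 2"
    and "(x, y) \<in> unit_square"
  shows "\<bar>f (x, y) - akr_operator n m j f (x, y)\<bar>
    \<le> x * (1 - x) / (2 * real n) * sup_norm (mixed_partial 2 0 f)
      + y * (1 - y) / (2 * real m) * sup_norm (mixed_partial 0 2 f)
      + (real j - 1) / real n * sup_norm (mixed_partial 1 0 f)
      + (real j - 1) / real m * sup_norm (mixed_partial 0 1 f)"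
proof -
  let ?t = "akr_node j n" and ?u = "akr_node j m"
  have xy: "x \<in> {0..1}" "y \<in> {0..1}" using assms(5) by auto
  have f00: "mixed_partial 0 0 f = f" by (simp add: mixed_partial_def)
  have pos: "0 < j" "0 < n" "0 < m" using assms by auto
  have first: "\<bar>f (x, y) - (\<Sum>i\<le>n. f (?t i, y) * Bernstein n i x)\<bar>
      \<le> x * (1 - x) / (2 * real n) * sup_norm (mixed_partial 2 0 f)
        + (real j - 1) / real n * sup_norm (mixed_partial 1 0 f)"
  proof (rule perturbed_Bernstein_error[where g = "\<lambda>s. f (s, y)"
        and g' = "\<lambda>s. mixed_partial 1 0 f (s, y)" and g'' = "\<lambda>s. mixed_partial 2 0 f (s, y)"])
    fix s :: real assume s: "s \<in> {0..1}"
    show "((\<lambda>s. f (s, y)) has_real_derivative mixed_partial 1 0 f (s, y)) (at s within {0..1})"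
      using C_pq_derivative_x[OF assms(4), of 0 0 s y] s xy by (simp add: f00)
    show "((\<lambda>s. mixed_partial 1 0 f (s, y)) has_real_derivative mixed_partial 2 0 f (s, y))
        (at s within {0..1})"
      using C_pq_derivative_x[OF assms(4), of 1 0 s y] s xy by (simp add: numeral_2_eq_2)
    show "\<bar>mixed_partial 1 0 f (s, y)\<bar> \<le> sup_norm (mixed_partial 1 0 f)"
      "\<bar>mixed_partial 2 0 f (s, y)\<bar> \<le> sup_norm (mixed_partial 2 0 f)"
      using s xy by (auto intro!: C_pq_abs_le_sup_norm[OF assms(4)])
  qed (use akr_node_bounds[OF pos(1) assms(2)] pos xy in blast)+
  have second: "\<bar>f (s, y) - (\<Sum>k\<le>m. f (s, ?u k) * Bernstein m k y)\<bar>
      \<le> y * (1 - y) / (2 * real m) * sup_norm (mixed_partial 0 2 f)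
        + (real j - 1) / real m * sup_norm (mixed_partial 0 1 f)" if s: "s \<in> {0..1}" for s
  proof (rule perturbed_Bernstein_error[where g = "\<lambda>t. f (s, t)"
        and g' = "\<lambda>t. mixed_partial 0 1 f (s, t)" and g'' = "\<lambda>t. mixed_partial 0 2 f (s, t)"])
    fix t :: real assume t: "t \<in> {0..1}"
    show "((\<lambda>t. f (s, t)) has_real_derivative mixed_partial 0 1 f (s, t)) (at t within {0..1})"
      using C_pq_derivative_y[OF assms(4), of 0 s t] s t by (simp add: f00)
    show "((\<lambda>t. mixed_partial 0 1 f (s, t)) has_real_derivative mixed_partial 0 2 f (s, t))
        (at t within {0..1})"
      using C_pq_derivative_y[OF assms(4), of 1 s t] s t by (simp add: numeral_2_eq_2)
    show "\<bar>mixed_partial 0 1 f (s, t)\<bar> \<le> sup_norm (mixed_partial 0 1 f)"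
      "\<bar>mixed_partial 0 2 f (s, t)\<bar> \<le> sup_norm (mixed_partial 0 2 f)"
      using s t by (auto intro!: C_pq_abs_le_sup_norm[OF assms(4)])
  qed (use akr_node_bounds[OF pos(1) assms(3)] pos xy in blast)+
  \<comment> \<open>The error in the second variable is averaged over the lines through the nodes \<open>?t i\<close>.\<close>
  have "\<bar>\<Sum>i\<le>n. (f (?t i, y) - (\<Sum>k\<le>m. f (?t i, ?u k) * Bernstein m k y)) * Bernstein n i x\<bar>
      \<le> y * (1 - y) / (2 * real m) * sup_norm (mixed_partial 0 2 f)
        + (real j - 1) / real m * sup_norm (mixed_partial 0 1 f)"
    using xy akr_node_bounds(1)[OF pos(1) assms(2)]
    by (intro abs_Bernstein_average_le second) auto
  moreover have "(\<Sum>i\<le>n. (f (?t i, y) - (\<Sum>k\<le>m. f (?t i, ?u k) * Bernstein m k y)) * Bernstein n i x)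
      = (\<Sum>i\<le>n. f (?t i, y) * Bernstein n i x) - akr_operator n m j f (x, y)"
    by (simp add: akr_operator_def left_diff_distrib sum_subtractf sum_distrib_right
        mult.assoc mult.commute[of "Bernstein m _ y"])
  ultimately show ?thesis using first by linarith
qed

end
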